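(* Let $S$ be a $*$-monoid and let $a\in S$. Then the following conditions are equivalent: (i) $a$ is right g-MP invertible; (ii) $a^*a$ is right invertible along $a$; (iii) there exists $c\in S$ such that $aa^*ac=a$ and $cS\subseteq aS$. In this case, $ast$ is a right inverse of $a^*a$ along $a$ for all $s,t\in S$ such that $a=a^2s=aa^*at$, and $ca^*ac$ is a right inverse of $a^*a$ along $a$ for any $c$ as in (iii).
   Context: A $*$-monoid is a monoid $S$ with a map $*:S\to S$ satisfying $(x^* )^*=x$ and $(xy)^*=y^*x^*$ for all $x,y\in S$. An element $a\in S$ is right g-MP invertible if $aS=a^2S=aa^*aS$. For $a,b\in S$, write $a\leq_{\mathcal R}b$ if $aS\subseteq bS$, equivalently $a=by$ for some $y\in S$. For $c,d\in S$, an element $b\in S$ is a right inverse of $c$ along $d$ if $dcb=d$ and $b\leq_{\mathcal R}d$; $c$ is right invertible along $d$ if such a $b$ exists. *)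

theory Defs
  imports Main
begin

class star_monoid = monoid_mult +
  fixes star :: "'a \<Rightarrow> 'a"
  assumes star_star: "star (star x) = x"
    and star_mult: "star (x * y) = star y * star x"

text \<open>The principal right ideal \<open>x S\<close>.\<close>

definition rideal :: "'a::monoid_mult \<Rightarrow> 'a set" where
  "rideal x = {x * y | y. True}"

definition le_R :: "'a::monoid_mult \<Rightarrow> 'a \<Rightarrow> bool" (infix "\<le>\<^sub>R" 50) where
  "a \<le>\<^sub>R b \<longleftrightarrow> rideal a \<subseteq> rideal b"

definition right_gMP_invertible :: "'a::star_monoid \<Rightarrow> bool" where
  "right_gMP_invertible a \<longleftrightarrow>
    rideal a = rideal (a ^ 2) \<and> rideal (a ^ 2) = rideal (a * star a * a)"

text \<open>Argument order: \<open>right_inverse_along b c d\<close> says that \<open>b\<close> is a right inverse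
  of \<open>c\<close> along \<open>d\<close>.\<close>

definition right_inverse_along :: "'a::monoid_mult \<Rightarrow> 'a \<Rightarrow> 'a \<Rightarrow> bool" where
  "right_inverse_along b c d \<longleftrightarrow> d * c * b = d \<and> b \<le>\<^sub>R d"

definition right_invertible_along :: "'a::monoid_mult \<Rightarrow> 'a \<Rightarrow> bool" where
  "right_invertible_along c d \<longleftrightarrow> (\<exists>b. right_inverse_along b c d)"

end

theory Submission
  imports Defs
begin

text \<open>
  If \<open>a = a a\<^sup>* a c\<close>, then \<open>a\<^sup>* a c\<close> is self-adjoint, and so is \<open>a c a\<^sup>*\<close>;
  this turns the factorisation around into \<open>a = a c a\<^sup>* a\<close>. If moreover \<open>c \<in> a S\<close>,
  then \<open>a c \<in> a\<^sup>2 S\<close>, whence \<open>a \<in> a\<^sup>2 S\<close>.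
\<close>

lemma rideal_subset_iff:
  fixes x y :: "'a::monoid_mult"
  shows "rideal x \<subseteq> rideal y \<longleftrightarrow> (\<exists>z. x = y * z)"
proof
  assume "rideal x \<subseteq> rideal y"
  moreover have "x \<in> rideal x"
    unfolding rideal_def by (metis (mono_tags) mem_Collect_eq mult_1_right)
  ultimately show "\<exists>z. x = y * z"
    unfolding rideal_def by blast
next
  assume "\<exists>z. x = y * z"
  then show "rideal x \<subseteq> rideal y"
    unfolding rideal_def by (auto simp: mult.assoc)
qed

text \<open>Both \<open>a ^ 2\<close> and \<open>a * star a * a\<close> are right multiples of
  \<open>a\<close>, so only the reverse inclusions carry content.\<close>

lemma right_gMP_invertible_iff:
  fixes a :: "'a::star_monoid"
  shows "right_gMP_invertible a \<longleftrightarrow> (\<exists>s. a = a ^ 2 * s) \<and> (\<exists>t. a = a * star a * a * t)"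
proof -
  have "rideal (a ^ 2) \<subseteq> rideal a" "rideal (a * star a * a) \<subseteq> rideal a"
    unfolding rideal_subset_iff by (auto simp: power2_eq_square mult.assoc)
  then show ?thesis
    unfolding right_gMP_invertible_def rideal_subset_iff[symmetric] by blast
qed

lemma factor_through_star_swap:
  fixes a :: "'a::star_monoid"
  assumes c: "a * star a * a * c = a"
  shows "a * c * star a * a = a"
proof -
  have "star a = star (a * star a * a * c)"
    by (simp add: c)
  then have star_a: "star a = star c * star a * a * star a"
    by (simp add: star_mult star_star mult.assoc)
  \<comment> \<open>Expanding the leading \<open>star a\<close> makes
    \<open>a * star a * a * c\<close> reappear; it collapses to \<open>a\<close>, leaving the
    adjoint of the left-hand side.\<close>
  have "star a * a * c = star c * star a * (a * star a * a * c)"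
    by (subst star_a) (simp add: mult.assoc)
  then have sa: "star a * a * c = star c * star a * a"
    by (simp add: c)
  have a: "a = a * star c * star a * a"
    using c by (metis sa mult.assoc)
  then have "star a = star (a * star c * star a * a)"
    by simp
  then have star_a': "star a = star a * a * c * star a"
    by (simp add: star_mult star_star mult.assoc)
  \<comment> \<open>The leading \<open>a\<close> is expanded, then the tail is contracted to
    \<open>star a\<close>; the result is the adjoint of \<open>a * c * star a\<close>.\<close>
  have "a * c * star a = a * star c * star a * a * c * star a"
    using a by simp
  also have "\<dots> = a * star c * (star a * a * c * star a)"
    by (simp only: mult.assoc)
  also have "\<dots> = a * star c * star a"
    using star_a' by simp
  finally show ?thesis
    using a by simp
qed

theorem theorem2p11:
  fixes a :: "'a::star_monoid"
  shows "(right_gMP_invertible a \<longleftrightarrow> right_invertible_along (star a * a) a)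
    \<and> (right_invertible_along (star a * a) a \<longleftrightarrow>
        (\<exists>c. a * star a * a * c = a \<and> rideal c \<subseteq> rideal a))
    \<and> (right_gMP_invertible a \<longrightarrow>
        (\<forall>s t. a = a ^ 2 * s \<and> a = a * star a * a * t \<longrightarrow>
          right_inverse_along (a * s * t) (star a * a) a)
        \<and> (\<forall>c. a * star a * a * c = a \<and> rideal c \<subseteq> rideal a \<longrightarrow>
          right_inverse_along (c * star a * a * c) (star a * a) a))"
proof -
  let ?iii = "\<lambda>c. a * star a * a * c = a \<and> rideal c \<subseteq> rideal a"
  \<comment> \<open>Up to associativity, (ii) and (iii) have the same witnesses, so both explicit
    inverses need only be checked against \<open>?iii\<close>.\<close>
  have inverse_iff: "right_inverse_along b (star a * a) a \<longleftrightarrow> ?iii b" for b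
    unfolding right_inverse_along_def le_R_def by (simp add: mult.assoc)
  have ast: "?iii (a * s * t)" if s: "a = a ^ 2 * s" and t: "a = a * star a * a * t" for s t
  proof
    have "a * star a * a * (a * s * t) = a * star a * (a ^ 2 * s) * t"
      by (simp add: power2_eq_square mult.assoc)
    also have "\<dots> = a"
      using s t by simp
    finally show "a * star a * a * (a * s * t) = a" .
    show "rideal (a * s * t) \<subseteq> rideal a"
      unfolding rideal_subset_iff by (auto simp: mult.assoc)
  qed
  have cac: "?iii (c * star a * a * c)" if c: "?iii c" for c
  proof
    \<comment> \<open>The hypothesis on \<open>c\<close> applies twice: the bracket becomes
      \<open>a\<close>, which restores the same product.\<close>
    have "a * star a * a * (c * star a * a * c) = (a * star a * a * c) * star a * a * c"
      by (simp only: mult.assoc)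
    then show "a * star a * a * (c * star a * a * c) = a"
      using c by simp
    show "rideal (c * star a * a * c) \<subseteq> rideal a"
      using c unfolding rideal_subset_iff by (metis mult.assoc)
  qed
  have gMP: "right_gMP_invertible a" if c: "?iii c" for c
  proof -
    obtain y where y: "c = a * y"
      using c rideal_subset_iff by blast
    \<comment> \<open>Substituting \<open>c = a * y\<close> into
      \<open>a * c * star a * a = a\<close> brings out the factor \<open>a ^ 2\<close>.\<close>
    have "a = a ^ 2 * (y * star a * a)"
      using factor_through_star_swap[of a c] c y by (simp add: power2_eq_square mult.assoc)
    moreover have "a = a * star a * a * c"
      using c by simp
    ultimately show ?thesis
      unfolding right_gMP_invertible_iff by blast
  qed
  have "right_gMP_invertible a \<longleftrightarrow> (\<exists>c. ?iii c)"
    using ast gMP unfolding right_gMP_invertible_iff by blast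
  then show ?thesis
    using ast cac unfolding right_invertible_along_def inverse_iff by blast
qed

end
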